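(* Let $\mathbf{r}_0\in\mathbb{N}^4$. For any matrix $X\in\mathsf{M}^0(\mathbf{r}_0;\mathbb{H})$ of degree $0$, the graded determinant $\Gamma\!\det(X)$ is a real number and its absolute value coincides with the Dieudonné determinant: $$|\Gamma\!\det(X)|=\mathrm{D}\!\det(X).$$
   Context: The algebra $\mathbb{H}$ of quaternions is graded by the even subgroup $(\mathbb{Z}_2)^3_{\,0}=\{\gamma_1=(0,0,0),\gamma_2=(0,1,1),\gamma_3=(1,0,1),\gamma_4=(1,1,0)\}$ of $(\mathbb{Z}_2)^3$ with $\mathbb{H}^{(0,0,0)}=\mathbb{R}1$, $\mathbb{H}^{(0,1,1)}=\mathbb{R}i$, $\mathbb{H}^{(1,0,1)}=\mathbb{R}j$, $\mathbb{H}^{(1,1,0)}=\mathbb{R}k$; it is graded commutative: $ba=(-1)^{\langle\tilde a,\tilde b\rangle}ab$ for homogeneous $a,b$ of degrees $\tilde a,\tilde b$, where $\langle\gamma,\gamma'\rangle=\sum_i\gamma_i\gamma'_i\in\mathbb{Z}_2$. For $\mathbf{r}_0=(r_1,\dots,r_4)$, $\mathsf{M}^0(\mathbf{r}_0;\mathbb{H})$ is the algebra of $4\times4$ block matrices $X=(X_{ku})$ with $X_{ku}$ of size $r_k\times r_u$ and entries in $\mathbb{H}^{\gamma_k+\gamma_u}$. The graded determinant is the unique map $\Gamma\!\det:\mathsf{M}^0(\mathbf{r}_0;\mathbb{H})\to\mathbb{H}^{0}=\mathbb{R}$ that is multiplicative, equals $\prod_k\det(X_{kk})$ on block-diagonal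 matrices, and equals $1$ on block-unitriangular matrices (block triangular with identity diagonal blocks). Explicitly it is the polynomial in the entries of $X$ which coincides with $\prod_{k=0}^{3}\det|X^{1\ldots k,1\ldots k}|_{k+1\,k+1}$ whenever the inverses involved exist, where $X^{1\ldots k,1\ldots k}$ is $X$ with its first $k$ block rows and columns deleted, and $|X^{1\ldots k,1\ldots k}|_{k+1\,k+1}=X_{k+1,k+1}-(X_{k+1,b})_{b>k+1}(X^{1\ldots k+1,1\ldots k+1})^{-1}(X_{a,k+1})_{a>k+1}$. The Dieudonné determinant $\mathrm{D}\!\det(X)\in\mathbb{R}_{\ge0}$ of an $N\times N$ quaternionic matrix is normalized by the quaternionic norm $\|q\|=\sqrt{q\bar q}$: it is $0$ if $X$ is not invertible, and on invertible matrices it is the unique homomorphism to $\mathbb{R}_{>0}$ that equals $1$ on elementary transvection matrices and $\|q\|$ on $\mathrm{diag}(q,1,\dots,1)$. *)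

theory Defs
  imports
    "Jordan_Normal_Form.Determinant"
    "HOL-Library.Z2"
    "HOL-Library.Product_Plus"
    "HOL-Library.FuncSet"
begin

section \<open>Quaternions\<close>

datatype quat = Quat (qRe: real) (qI: real) (qJ: real) (qK: real)

lemma quat_eq_iff: "x = y \<longleftrightarrow> qRe x = qRe y \<and> qI x = qI y \<and> qJ x = qJ y \<and> qK x = qK y"
  by (cases x; cases y) auto

instantiation quat :: real_algebra_1
begin

definition "0 = Quat 0 0 0 0"
definition "1 = Quat 1 0 0 0"
definition "x + y = Quat (qRe x + qRe y) (qI x + qI y) (qJ x + qJ y) (qK x + qK y)"
definition "x - y = Quat (qRe x - qRe y) (qI x - qI y) (qJ x - qJ y) (qK x - qK y)"
definition "- x = Quat (- qRe x) (- qI x) (- qJ x) (- qK x)"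
definition "scaleR t x = Quat (t * qRe x) (t * qI x) (t * qJ x) (t * qK x)"
definition "x * y = Quat
  (qRe x * qRe y - qI x * qI y - qJ x * qJ y - qK x * qK y)
  (qRe x * qI y + qI x * qRe y + qJ x * qK y - qK x * qJ y)
  (qRe x * qJ y - qI x * qK y + qJ x * qRe y + qK x * qI y)
  (qRe x * qK y + qI x * qJ y - qJ x * qI y + qK x * qRe y)"

instance
  by standard
    (simp_all add: quat_eq_iff zero_quat_def one_quat_def plus_quat_def minus_quat_def
      uminus_quat_def scaleR_quat_def times_quat_def algebra_simps)

end

lemma quat_sel [simp]:
  "qRe 0 = 0" "qI 0 = 0" "qJ 0 = 0" "qK 0 = 0"
  "qRe 1 = 1" "qI 1 = 0" "qJ 1 = 0" "qK 1 = 0"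
  "qRe (x + y) = qRe x + qRe y" "qI (x + y) = qI x + qI y"
  "qJ (x + y) = qJ x + qJ y" "qK (x + y) = qK x + qK y"
  "qRe (x - y) = qRe x - qRe y" "qI (x - y) = qI x - qI y"
  "qJ (x - y) = qJ x - qJ y" "qK (x - y) = qK x - qK y"
  "qRe (- x) = - qRe x" "qI (- x) = - qI x" "qJ (- x) = - qJ x" "qK (- x) = - qK x"
  "qRe (t *\<^sub>R x) = t * qRe x" "qI (t *\<^sub>R x) = t * qI x"
  "qJ (t *\<^sub>R x) = t * qJ x" "qK (t *\<^sub>R x) = t * qK x"
  "qRe (x * y) = qRe x * qRe y - qI x * qI y - qJ x * qJ y - qK x * qK y"
  "qI (x * y) = qRe x * qI y + qI x * qRe y + qJ x * qK y - qK x * qJ y"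
  "qJ (x * y) = qRe x * qJ y - qI x * qK y + qJ x * qRe y + qK x * qI y"
  "qK (x * y) = qRe x * qK y + qI x * qJ y - qJ x * qI y + qK x * qRe y"
  by (simp_all add: zero_quat_def one_quat_def plus_quat_def minus_quat_def
      uminus_quat_def scaleR_quat_def times_quat_def)

lemma of_real_quat_sel [simp]:
  "qRe (of_real t) = t" "qI (of_real t) = 0" "qJ (of_real t) = 0" "qK (of_real t) = 0"
  by (simp_all add: of_real_def)

definition qcnj :: "quat \<Rightarrow> quat" where
  "qcnj x = Quat (qRe x) (- qI x) (- qJ x) (- qK x)"

instantiation quat :: real_normed_div_algebra
begin

definition norm_quat_def: "norm x = sqrt (qRe (x * qcnj x))"

definition inverse_quat_def: "inverse x = qcnj x /\<^sub>R (norm x)\<^sup>2"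

definition divide_quat_def: "x div (y :: quat) = x * inverse y"

definition sgn_quat_def: "sgn x = x /\<^sub>R norm (x :: quat)"

definition dist_quat_def: "dist x y = norm (x - y :: quat)"

definition uniformity_quat_def:
  "(uniformity :: (quat \<times> quat) filter) = (INF e\<in>{0 <..}. principal {(x, y). dist x y < e})"

definition open_quat_def:
  "open (U :: quat set) \<longleftrightarrow> (\<forall>x\<in>U. eventually (\<lambda>(x', y). x' = x \<longrightarrow> y \<in> U) uniformity)"

lemma norm_quat_eq:
  "norm x = sqrt ((qRe x)\<^sup>2 + (qI x)\<^sup>2 + (qJ x)\<^sup>2 + (qK x)\<^sup>2)"
  by (simp add: norm_quat_def qcnj_def power2_eq_square)

lemma norm_quat_zero_iff: "norm x = 0 \<longleftrightarrow> x = (0 :: quat)"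
  by (simp add: norm_quat_eq quat_eq_iff add_nonneg_eq_0_iff)

lemma quat_mult_cnj: "x * qcnj x = (norm x)\<^sup>2 *\<^sub>R 1" "qcnj x * x = (norm x)\<^sup>2 *\<^sub>R 1"
  by (simp_all add: norm_quat_eq qcnj_def quat_eq_iff power2_eq_square algebra_simps)

lemma norm_quat_cmod: "norm x =
    sqrt ((cmod (Complex (qRe x) (qI x)))\<^sup>2 + (cmod (Complex (qJ x) (qK x)))\<^sup>2)"
  by (simp add: norm_quat_eq complex_norm add.assoc)

instance
proof
  fix t :: real and x y :: quat
  show "x \<noteq> 0 \<Longrightarrow> inverse x * x = 1" "x \<noteq> 0 \<Longrightarrow> x * inverse x = 1"
    by (simp_all add: inverse_quat_def quat_mult_cnj norm_quat_zero_iff)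
  show "inverse (0 :: quat) = 0"
    by (simp add: inverse_quat_def qcnj_def quat_eq_iff)
  show "(norm x = 0) = (x = 0)"
    by (rule norm_quat_zero_iff)
  show "norm (x + y) \<le> norm x + norm y"
  proof -
    let ?a = "\<lambda>q. Complex (qRe q) (qI q)" and ?b = "\<lambda>q. Complex (qJ q) (qK q)"
    have "norm (x + y) = sqrt ((cmod (?a x + ?a y))\<^sup>2 + (cmod (?b x + ?b y))\<^sup>2)"
      by (simp add: norm_quat_cmod complex_add)
    also have "\<dots> \<le> sqrt ((cmod (?a x) + cmod (?a y))\<^sup>2 + (cmod (?b x) + cmod (?b y))\<^sup>2)"
      by (intro real_sqrt_le_mono add_mono power_mono norm_triangle_ineq norm_ge_zero)
    also have "\<dots> \<le> norm x + norm y"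
      unfolding norm_quat_cmod by (rule real_sqrt_sum_squares_triangle_ineq)
    finally show ?thesis .
  qed
  show "norm (t *\<^sub>R x) = \<bar>t\<bar> * norm x"
    by (simp add: norm_quat_eq power_mult_distrib distrib_left [symmetric] real_sqrt_mult)
  show "norm (x * y) = norm x * norm y"
    by (simp add: norm_quat_eq real_sqrt_mult [symmetric] power2_eq_square algebra_simps)
qed (rule divide_quat_def sgn_quat_def dist_quat_def open_quat_def uniformity_quat_def)+

end

definition qi :: quat where "qi = Quat 0 1 0 0"
definition qj :: quat where "qj = Quat 0 0 1 0"
definition qk :: quat where "qk = Quat 0 0 0 1"

lemma quat_units:
  "qi * qi = -1" "qj * qj = -1" "qk * qk = -1"
  "qi * qj = qk" "qj * qk = qi" "qk * qi = qj"
  by (simp_all add: quat_eq_iff qi_def qj_def qk_def)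


section \<open>The grading\<close>

type_synonym degree = "bit \<times> bit \<times> bit"

text \<open>The list \<open>\<gamma>\<^sub>1, \<dots>, \<gamma>\<^sub>4\<close> of the even degrees; block indices are shifted, so that
  they run over \<open>{..<4}\<close>.\<close>

definition gam :: "nat \<Rightarrow> degree" where
  "gam k = [(0,0,0), (0,1,1), (1,0,1), (1,1,0)] ! k"

text \<open>The component of quaternions of a given degree (zero for odd degrees).\<close>

definition hcomp :: "degree \<Rightarrow> quat set" where
  "hcomp d =
    (if d = (0,0,0) then range (\<lambda>t. t *\<^sub>R 1)
     else if d = (0,1,1) then range (\<lambda>t. t *\<^sub>R qi)
     else if d = (1,0,1) then range (\<lambda>t. t *\<^sub>R qj)
     else if d = (1,1,0) then range (\<lambda>t. t *\<^sub>R qk)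
     else {0})"

definition dpair :: "degree \<Rightarrow> degree \<Rightarrow> bit" where
  "dpair d e = fst d * fst e + fst (snd d) * fst (snd e) + snd (snd d) * snd (snd e)"

lemma hcomp_graded_commutative:
  assumes "a \<in> hcomp d" "b \<in> hcomp e"
  shows "b * a = (if dpair d e = 0 then a * b else - (a * b))"
  using assms
  by (auto simp: hcomp_def dpair_def qi_def qj_def qk_def quat_eq_iff split: if_splits)

lemma hcomp_mult:
  assumes "a \<in> hcomp d" "b \<in> hcomp e"
  shows "a * b \<in> hcomp (d + e)"
  using assms
  by (auto simp: hcomp_def qi_def qj_def qk_def quat_eq_iff image_iff zero_prod_def
      split: if_splits)


section \<open>Degree-0 block matrices and the graded determinant\<close>

text \<open>\<open>r = [r\<^sub>1, \<dots>, r\<^sub>4]\<close> lists the block sizes; sizes \<open>0\<close> are allowed.\<close>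

definition block :: "nat list \<Rightarrow> 'a mat \<Rightarrow> nat \<Rightarrow> nat \<Rightarrow> 'a mat" where
  "block r X k u = mat (r ! k) (r ! u)
     (\<lambda>(a, b). X $$ (sum_list (take k r) + a, sum_list (take u r) + b))"

definition M0 :: "nat list \<Rightarrow> quat mat set" where
  "M0 r = {X \<in> carrier_mat (sum_list r) (sum_list r).
     \<forall>k<4. \<forall>u<4. elements_mat (block r X k u) \<subseteq> hcomp (gam k + gam u)}"

definition block_upper :: "nat list \<Rightarrow> quat mat \<Rightarrow> bool" where
  "block_upper r X \<longleftrightarrow> (\<forall>k<4. \<forall>u<k. block r X k u = 0\<^sub>m (r ! k) (r ! u))"

definition block_lower :: "nat list \<Rightarrow> quat mat \<Rightarrow> bool" where
  "block_lower r X \<longleftrightarrow> (\<forall>u<4. \<forall>k<u. block r X k u = 0\<^sub>m (r ! k) (r ! u))"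

definition block_diagonal :: "nat list \<Rightarrow> quat mat \<Rightarrow> bool" where
  "block_diagonal r X \<longleftrightarrow> block_upper r X \<and> block_lower r X"

definition block_unitriangular :: "nat list \<Rightarrow> quat mat \<Rightarrow> bool" where
  "block_unitriangular r X \<longleftrightarrow>
     (block_upper r X \<or> block_lower r X) \<and> (\<forall>k<4. block r X k k = 1\<^sub>m (r ! k))"

text \<open>The diagonal blocks of a degree-0 matrix have entries in \<open>hcomp 0 = \<real>\<close>; their
  determinants are taken over the reals.\<close>

definition is_graded_det :: "nat list \<Rightarrow> (quat mat \<Rightarrow> quat) \<Rightarrow> bool" where
  "is_graded_det r F \<longleftrightarrow>
     F \<in> M0 r \<rightarrow>\<^sub>E hcomp (0,0,0) \<and>
     (\<forall>X\<in>M0 r. \<forall>Y\<in>M0 r. F (X * Y) = F X * F Y) \<and>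
     (\<forall>X\<in>M0 r. block_diagonal r X \<longrightarrow>
        F X = of_real (\<Prod>k<4. det (map_mat qRe (block r X k k)))) \<and>
     (\<forall>X\<in>M0 r. block_unitriangular r X \<longrightarrow> F X = 1)"

definition graded_det :: "nat list \<Rightarrow> quat mat \<Rightarrow> quat" where
  "graded_det r = (THE F. is_graded_det r F)"


section \<open>The Dieudonne determinant\<close>

definition GL :: "nat \<Rightarrow> quat mat set" where
  "GL n = {A \<in> carrier_mat n n. invertible_mat A}"

text \<open>\<open>addrow_mat n q k l\<close> is the transvection matrix \<open>1 + q E\<^sub>k\<^sub>l\<close>.
  The last clause is void for \<open>n = 0\<close>, where the group is trivial.\<close>

definition is_dieudonne_hom :: "nat \<Rightarrow> (quat mat \<Rightarrow> real) \<Rightarrow> bool" where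
  "is_dieudonne_hom n F \<longleftrightarrow>
     F \<in> GL n \<rightarrow>\<^sub>E {0<..} \<and>
     (\<forall>A\<in>GL n. \<forall>B\<in>GL n. F (A * B) = F A * F B) \<and>
     (\<forall>q k l. k < n \<longrightarrow> l < n \<longrightarrow> k \<noteq> l \<longrightarrow> F (addrow_mat n q k l) = 1) \<and>
     (\<forall>q. 0 < n \<longrightarrow> q \<noteq> 0 \<longrightarrow> F (mat_diag n (\<lambda>i. if i = 0 then q else 1)) = norm q)"

definition dieudonne_det :: "quat mat \<Rightarrow> real" where
  "dieudonne_det X =
     (if invertible_mat X then (THE F. is_dieudonne_hom (dim_row X) F) X else 0)"

end

theory Submission
  imports Defs
begin

text \<open>
  The unit quaternions \<open>1, i, j, k\<close> are homogeneous of the four even degrees and each is inverse to its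
  conjugate, so the component of degree \<open>\<gamma>\<^sub>k + \<gamma>\<^sub>u\<close> is the real line through \<open>e\<^sub>k e\<^sub>u\<^sup>-\<^sup>1\<close>. Hence a
  degree-0 matrix is \<open>X = E Y E\<^sup>-\<^sup>1\<close> with \<open>Y\<close> an arbitrary real matrix and \<open>E\<close> the diagonal matrix
  that carries the unit \<open>e\<^sub>k\<close> throughout the block \<open>k\<close> (\<open>twist\<close>, \<open>twist_untwist\<close>). This isomorphism
  of \<open>M0 r\<close> with a full real matrix algebra preserves the block structure and the real diagonal
  blocks. Both determinants of \<open>X\<close> are then expressed by \<open>det Y\<close>.

  For the graded determinant, \<open>X \<mapsto> det Y\<close> has the defining properties because the determinant of a
  block triangular matrix is the product of those of its diagonal blocks (\<open>det_block_upper\<close>).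
  It is the only such function: every matrix over a division ring becomes diagonal after
  multiplication by transvections on both sides (\<open>transvection_equiv_diagonal\<close>); a real-valued
  multiplicative function that is \<open>1\<close> at the identity is \<open>1\<close> on transvections, each of which is a square and is conjugate to its
  inverse (\<open>multiplicative_addrow_mat\<close>); and the values on diagonal matrices are prescribed. This
  argument covers singular matrices as well.

  The Dieudonne determinant is obtained by writing quaternions as \<open>2 \<times> 2\<close> complex matrices: the
  square root of the modulus of the resulting complex determinant (\<open>norm_det\<close>) is
  multiplicative on all quaternionic matrices and has the required values, and the same diagonalization shows
  that it is the only such homomorphism. On a real matrix the complex determinant is
  \<open>(det Y)\<^sup>2\<close>, so \<open>norm_det\<close> is \<open>\<bar>det Y\<bar>\<close> there, and the factors \<open>E\<close> and \<open>E\<^sup>-\<^sup>1\<close> cancel by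
  multiplicativity.
\<close>

section \<open>Diagonalization by transvections\<close>

inductive_set transvection_products :: "nat \<Rightarrow> 'a :: ring_1 mat set" for n where
  one: "1\<^sub>m n \<in> transvection_products n"
| step: "T \<in> transvection_products n \<Longrightarrow> k < n \<Longrightarrow> l < n \<Longrightarrow> k \<noteq> l \<Longrightarrow>
    addrow_mat n q k l * T \<in> transvection_products n"

lemma transvection_products_carrier:
  "T \<in> transvection_products n \<Longrightarrow> T \<in> carrier_mat n n"
  by (induction rule: transvection_products.induct) auto

lemma transvection_products_mult:
  assumes "S \<in> transvection_products n" "T \<in> transvection_products n"
  shows "S * T \<in> transvection_products n"
  using assms(1)
proof induction
  case one
  then show ?case
    using assms(2) transvection_products_carrier[OF assms(2)] by (simp add: left_mult_one_mat)
next
  case (step S k l q)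
  have "addrow_mat n q k l * S * T = addrow_mat n q k l * (S * T)"
    using step.hyps assms(2)
    by (intro assoc_mult_mat[of _ n n _ n _ n]) (auto dest: transvection_products_carrier)
  then show ?case using step by (simp add: transvection_products.step)
qed

lemma addrow_mat_in_transvection_products:
  assumes "k < n" "l < n" "k \<noteq> l"
  shows "addrow_mat n q k l \<in> transvection_products n"
  using transvection_products.step[OF transvection_products.one assms, of q]
  by (simp add: right_mult_one_mat[of _ n])

lemma addrow_mat_mult_left:
  fixes A :: "'a :: ring_1 mat"
  assumes "A \<in> carrier_mat n n" "k < n" "l < n" "k \<noteq> l"
  shows "addrow_mat n q k l * A =
    mat n n (\<lambda>(i, j). if i = k then A $$ (k, j) + q * A $$ (l, j) else A $$ (i, j))"
proof -
  have "addrow_mat n q k l * A = addrow q k l A"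
    using assms by (simp add: addrow_mat)
  then show ?thesis using assms by (auto simp: add.commute)
qed

lemma addrow_mat_mult_right:
  fixes A :: "'a :: ring_1 mat"
  assumes "A \<in> carrier_mat n n" "k < n" "l < n" "k \<noteq> l"
  shows "A * addrow_mat n q k l =
    mat n n (\<lambda>(i, j). if j = l then A $$ (i, l) + A $$ (i, k) * q else A $$ (i, j))"
proof (rule eq_matI, goal_cases)
  case (1 i j)
  have "(A * addrow_mat n q k l) $$ (i, j) =
      (\<Sum>m = 0..<n. A $$ (i, m) * (if m = j then 1 else 0)
        + (if m = k then (if j = l then A $$ (i, k) * q else 0) else 0))"
    using 1 assms by (auto simp: scalar_prod_def intro!: sum.cong simp: algebra_simps)
  also have "\<dots> = A $$ (i, j) + (if j = l then A $$ (i, k) * q else 0)"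
    using 1 assms by (simp add: sum.distrib if_distrib[of "\<lambda>x. _ * x"] cong: if_cong)
  finally show ?case using 1 by simp
qed (use assms in auto)

text \<open>Subtracting left multiples of the pivot row clears a column. Giving all entries after \<open>m\<close> rows,
  rather than only the zeros, makes the induction on \<open>m\<close> immediate: the pivot row never changes.\<close>

lemma clear_column:
  fixes A :: "'a :: division_ring mat"
  assumes A: "A \<in> carrier_mat n n" and k: "k < n" "A $$ (k, k) \<noteq> 0" and "m \<le> n"
  shows "\<exists>T\<in>transvection_products n. T * A = mat n n (\<lambda>(i, j).
    if i < m \<and> i \<noteq> k then A $$ (i, j) - A $$ (i, k) * inverse (A $$ (k, k)) * A $$ (k, j)
    else A $$ (i, j))"
  using \<open>m \<le> n\<close>
proof (induction m)
  case 0
  show ?case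
    using A by (intro bexI[OF _ transvection_products.one]) auto
next
  case (Suc m)
  let ?B = "\<lambda>m. mat n n (\<lambda>(i, j).
    if i < m \<and> i \<noteq> k then A $$ (i, j) - A $$ (i, k) * inverse (A $$ (k, k)) * A $$ (k, j)
    else A $$ (i, j))"
  obtain T where T: "T \<in> transvection_products n" "T * A = ?B m"
    using Suc by auto
  show ?case
  proof (cases "m = k")
    case True
    then have "?B (Suc m) = ?B m" by (auto simp: less_Suc_eq)
    then show ?thesis using T by auto
  next
    case False
    let ?E = "addrow_mat n (- (A $$ (m, k) * inverse (A $$ (k, k)))) m k"
    have "?E * T * A = ?E * (T * A)"
      using A transvection_products_carrier[OF T(1)]
      by (intro assoc_mult_mat[of _ n n _ n _ n]) auto
    also have "\<dots> = ?B (Suc m)"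
      unfolding T(2) using Suc.prems k False
      by (subst addrow_mat_mult_left) (auto simp: less_Suc_eq)
    finally have "?E * T * A = ?B (Suc m)" .
    moreover have "?E * T \<in> transvection_products n"
      using T(1) Suc.prems k(1) False by (intro transvection_products.step) auto
    ultimately show ?thesis by (rule bexI)
  qed
qed

text \<open>The mirror image, with right multiples of the pivot column. Over a noncommutative ring it cannot be
  obtained from the column version by transposing, since transposition does not reverse products.\<close>

lemma clear_row:
  fixes A :: "'a :: division_ring mat"
  assumes A: "A \<in> carrier_mat n n" and k: "k < n" "A $$ (k, k) \<noteq> 0" and "m \<le> n"
  shows "\<exists>T\<in>transvection_products n. A * T = mat n n (\<lambda>(i, j).
    if j < m \<and> j \<noteq> k then A $$ (i, j) - A $$ (i, k) * inverse (A $$ (k, k)) * A $$ (k, j)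
    else A $$ (i, j))"
  using \<open>m \<le> n\<close>
proof (induction m)
  case 0
  show ?case
    using A by (intro bexI[OF _ transvection_products.one]) auto
next
  case (Suc m)
  let ?B = "\<lambda>m. mat n n (\<lambda>(i, j).
    if j < m \<and> j \<noteq> k then A $$ (i, j) - A $$ (i, k) * inverse (A $$ (k, k)) * A $$ (k, j)
    else A $$ (i, j))"
  obtain T where T: "T \<in> transvection_products n" "A * T = ?B m"
    using Suc by auto
  show ?case
  proof (cases "m = k")
    case True
    then have "?B (Suc m) = ?B m" by (auto simp: less_Suc_eq)
    then show ?thesis using T by auto
  next
    case False
    let ?E = "addrow_mat n (- (inverse (A $$ (k, k)) * A $$ (k, m))) k m"
    have "A * (T * ?E) = A * T * ?E"
      using A transvection_products_carrier[OF T(1)]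
      by (intro assoc_mult_mat[of _ n n _ n _ n, symmetric]) auto
    also have "\<dots> = ?B (Suc m)"
      unfolding T(2) using Suc.prems k False
      by (subst addrow_mat_mult_right) (auto simp: less_Suc_eq mult.assoc)
    finally have "A * (T * ?E) = ?B (Suc m)" .
    moreover have "T * ?E \<in> transvection_products n"
      using T(1) Suc.prems k(1) False
      by (intro transvection_products_mult addrow_mat_in_transvection_products) auto
    ultimately show ?thesis by (rule bexI)
  qed
qed

definition diagonal_upto :: "nat \<Rightarrow> nat \<Rightarrow> 'a :: zero mat \<Rightarrow> bool" where
  "diagonal_upto n k A \<longleftrightarrow> (\<forall>i<n. \<forall>j<n. i \<noteq> j \<longrightarrow> min i j < k \<longrightarrow> A $$ (i, j) = 0)"

definition transvection_equiv :: "nat \<Rightarrow> 'a :: ring_1 mat \<Rightarrow> 'a mat \<Rightarrow> bool" where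
  "transvection_equiv n A B \<longleftrightarrow>
    (\<exists>S\<in>transvection_products n. \<exists>T\<in>transvection_products n. B = S * A * T)"

lemma transvection_equivI:
  assumes "A \<in> carrier_mat n n" "T \<in> transvection_products n"
  shows "transvection_equiv n A (T * A)" "transvection_equiv n A (A * T)"
proof -
  have "T * A = T * A * 1\<^sub>m n" "A * T = 1\<^sub>m n * A * T"
    using assms transvection_products_carrier[OF assms(2)]
    by (simp_all add: right_mult_one_mat[of _ n] left_mult_one_mat[of _ n n])
  then show "transvection_equiv n A (T * A)" "transvection_equiv n A (A * T)"
    unfolding transvection_equiv_def using assms(2) transvection_products.one by blast+
qed

lemma transvection_equiv_trans:
  assumes A: "A \<in> carrier_mat n n"
    and "transvection_equiv n A B" "transvection_equiv n B C"
  shows "transvection_equiv n A C"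
proof -
  obtain S T S' T' where *:
    "S \<in> transvection_products n" "T \<in> transvection_products n" "B = S * A * T"
    "S' \<in> transvection_products n" "T' \<in> transvection_products n" "C = S' * B * T'"
    using assms(2,3) unfolding transvection_equiv_def by blast
  note [simp] = A *(1,2,4,5)[THEN transvection_products_carrier]
  have "C = (S' * S) * A * (T * T')"
    unfolding *(3,6)
    by (simp add: assoc_mult_mat[of _ n n _ n _ n] mult_carrier_mat[of _ n n _ n])
  then show ?thesis
    unfolding transvection_equiv_def using * transvection_products_mult by blast
qed

lemma transvection_equiv_carrier:
  "A \<in> carrier_mat n n \<Longrightarrow> transvection_equiv n A B \<Longrightarrow> B \<in> carrier_mat n n"
  unfolding transvection_equiv_def
  by (auto intro!: mult_carrier_mat[of _ n n _ n] dest: transvection_products_carrier)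

text \<open>Once column \<open>k\<close> is clear apart from the pivot, clearing row \<open>k\<close> by column operations adds
  multiples of a column with a single nonzero entry, so nothing else is disturbed.\<close>

lemma diagonal_upto_Suc_pivot:
  fixes A :: "'a :: division_ring mat"
  assumes A: "A \<in> carrier_mat n n" and k: "k < n" "A $$ (k, k) \<noteq> 0"
    and diag: "diagonal_upto n k A"
  shows "\<exists>B. transvection_equiv n A B \<and> diagonal_upto n (Suc k) B"
proof -
  obtain S where S: "S \<in> transvection_products n" and SA: "S * A = mat n n (\<lambda>(i, j).
    if i < n \<and> i \<noteq> k then A $$ (i, j) - A $$ (i, k) * inverse (A $$ (k, k)) * A $$ (k, j)
    else A $$ (i, j))"
    using clear_column[OF A k le_refl] by blast
  define B where "B = S * A"
  have B: "B \<in> carrier_mat n n" "B $$ (k, k) \<noteq> 0"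
    using SA k by (simp_all add: B_def)
  obtain T where T: "T \<in> transvection_products n" and BT: "B * T = mat n n (\<lambda>(i, j).
    if j < n \<and> j \<noteq> k then B $$ (i, j) - B $$ (i, k) * inverse (B $$ (k, k)) * B $$ (k, j)
    else B $$ (i, j))"
    using clear_row[OF B(1) k(1) B(2) le_refl] by blast
  have "transvection_equiv n A (B * T)"
    using transvection_equiv_trans[OF A] transvection_equivI A B(1) S T unfolding B_def by blast
  moreover have "diagonal_upto n (Suc k) (B * T)"
    unfolding diagonal_upto_def
  proof (intro allI impI)
    fix i j assume ij: "i < n" "j < n" "i \<noteq> j" "min i j < Suc k"
    have low: "A $$ (i', j') = 0" if "i' < n" "j' < n" "i' \<noteq> j'" "i' < k \<or> j' < k" for i' j'
      using diag that unfolding diagonal_upto_def min_less_iff_disj by blast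
    have "B $$ (i', k) = 0" if "i' < n" "i' \<noteq> k" for i'
      using that k by (simp add: B_def SA mult.assoc)
    moreover have "B $$ (i', j') = 0" if "i' < n" "j' < n" "i' \<noteq> j'" "i' < k \<or> j' < k" for i' j'
      using that k low[OF that] low[of i' k] low[of k j'] by (auto simp: B_def SA)
    ultimately show "(B * T) $$ (i, j) = 0"
      using ij k B(2) unfolding BT
      by (auto simp: min_less_iff_disj less_Suc_eq mult.assoc[symmetric])
  qed
  ultimately show ?thesis by blast
qed

text \<open>If the pivot vanishes, a nonzero entry further down its column or along its row is added to it; if there is
  none, the row and column are already clear. The latter case is what makes singular matrices
  diagonalizable too.\<close>

lemma diagonal_upto_Suc:
  fixes A :: "'a :: division_ring mat"
  assumes A: "A \<in> carrier_mat n n" and k: "k < n" and diag: "diagonal_upto n k A"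
  shows "\<exists>B. transvection_equiv n A B \<and> diagonal_upto n (Suc k) B"
proof -
  have low: "A $$ (i', j') = 0" if "i' < n" "j' < n" "i' \<noteq> j'" "i' < k \<or> j' < k" for i' j'
    using diag that unfolding diagonal_upto_def min_less_iff_disj by blast
  have via: ?thesis if "transvection_equiv n A A'" "A' $$ (k, k) \<noteq> 0" "diagonal_upto n k A'" for A'
    using diagonal_upto_Suc_pivot[OF transvection_equiv_carrier[OF A that(1)] k that(2,3)]
      transvection_equiv_trans[OF A that(1)] by blast
  consider "A $$ (k, k) \<noteq> 0"
    | i where "A $$ (k, k) = 0" "k < i" "i < n" "A $$ (i, k) \<noteq> 0"
    | j where "A $$ (k, k) = 0" "k < j" "j < n" "A $$ (k, j) \<noteq> 0"
    | "\<forall>i<n. k < i \<longrightarrow> A $$ (i, k) = 0 \<and> A $$ (k, i) = 0"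
    by blast
  then show ?thesis
  proof cases
    case 1
    then show ?thesis using diagonal_upto_Suc_pivot assms by blast
  next
    case (2 i)
    show ?thesis
    proof (rule via)
      show "transvection_equiv n A (addrow_mat n 1 k i * A)"
        using 2 k A by (intro transvection_equivI addrow_mat_in_transvection_products) auto
      show "(addrow_mat n 1 k i * A) $$ (k, k) \<noteq> 0"
        using 2 k by (simp add: addrow_mat_mult_left[OF A])
      show "diagonal_upto n k (addrow_mat n 1 k i * A)"
        using 2 k low
        by (auto simp: addrow_mat_mult_left[OF A] diagonal_upto_def min_less_iff_disj)
    qed
  next
    case (3 j)
    show ?thesis
    proof (rule via)
      show "transvection_equiv n A (A * addrow_mat n 1 j k)"
        using 3 k A by (intro transvection_equivI addrow_mat_in_transvection_products) auto
      show "(A * addrow_mat n 1 j k) $$ (k, k) \<noteq> 0"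
        using 3 k by (simp add: addrow_mat_mult_right[OF A])
      show "diagonal_upto n k (A * addrow_mat n 1 j k)"
        using 3 k low
        by (auto simp: addrow_mat_mult_right[OF A] diagonal_upto_def min_less_iff_disj)
    qed
  next
    case 4
    have "diagonal_upto n (Suc k) A"
      unfolding diagonal_upto_def
    proof (intro allI impI)
      fix i j assume ij: "i < n" "j < n" "i \<noteq> j" "min i j < Suc k"
      then consider "i < k \<or> j < k" | "i = k" "k < j" | "j = k" "k < i"
        by linarith
      then show "A $$ (i, j) = 0"
        using 4 low ij by cases auto
    qed
    then show ?thesis
      using transvection_equivI(1)[OF A transvection_products.one] A
      by (auto simp: left_mult_one_mat)
  qed
qed

theorem transvection_equiv_diagonal:
  fixes A :: "'a :: division_ring mat"
  assumes A: "A \<in> carrier_mat n n"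
  shows "\<exists>d. transvection_equiv n A (mat_diag n d)"
proof -
  have "\<exists>B. transvection_equiv n A B \<and> diagonal_upto n k B" if "k \<le> n" for k
    using that
  proof (induction k)
    case 0
    then show ?case
      using transvection_equivI(1)[OF A transvection_products.one]
      by (auto simp: diagonal_upto_def)
  next
    case (Suc k)
    then obtain B where B: "transvection_equiv n A B" "diagonal_upto n k B" by auto
    then show ?case
      using diagonal_upto_Suc[OF transvection_equiv_carrier[OF A B(1)] _ B(2)] Suc.prems
        transvection_equiv_trans[OF A B(1)] by auto
  qed
  then obtain B where B: "transvection_equiv n A B" "diagonal_upto n n B" by blast
  have eq: "mat_diag n (\<lambda>i. B $$ (i, i)) = B"
    using B transvection_equiv_carrier[OF A B(1)]
    by (auto simp: mat_diag_def diagonal_upto_def)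
  show ?thesis
    by (rule exI[of _ "\<lambda>i. B $$ (i, i)"]) (simp only: eq B(1))
qed

section \<open>Multiplicative functions on matrices\<close>

lemma addrow_mat_add:
  assumes "k < n" "l < n" "k \<noteq> l"
  shows "addrow_mat n p k l * addrow_mat n q k l = addrow_mat n (p + q :: 'a :: ring_1) k l"
  using assms by (subst addrow_mat_mult_left) auto

lemma addrow_mat_zero: "addrow_mat n 0 k l = 1\<^sub>m n"
  by auto

text \<open>Conjugation by the diagonal sign matrix with \<open>-1\<close> at \<open>k\<close> turns \<open>1 + p E\<^sub>k\<^sub>l\<close> into its inverse
  \<open>1 - p E\<^sub>k\<^sub>l\<close>, so the value \<open>v\<close> on it satisfies \<open>v\<^sup>2 = 1\<close>. As \<open>1 + q E\<^sub>k\<^sub>l\<close> is the square of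
  \<open>1 + (q/2) E\<^sub>k\<^sub>l\<close>, its own value is \<open>1\<close>. This is applied both
  to the graded determinant and to the complex one.\<close>

lemma multiplicative_addrow_mat:
  fixes F :: "'a :: real_algebra_1 mat \<Rightarrow> real"
  assumes mult: "\<And>A B. A \<in> carrier_mat n n \<Longrightarrow> B \<in> carrier_mat n n \<Longrightarrow> F (A * B) = F A * F B"
    and one: "F (1\<^sub>m n) = 1" and kl: "k < n" "l < n" "k \<noteq> l"
  shows "F (addrow_mat n q k l) = 1"
proof -
  have square: "(F (addrow_mat n p k l))\<^sup>2 = 1" for p
  proof -
    let ?T = "\<lambda>p :: 'a. addrow_mat n p k l" and ?S = "mat_diag n (\<lambda>i. if i = k then -1 else 1 :: 'a)"
    have "?S * ?S = mat_diag n (\<lambda>i. 1)"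
      unfolding mat_diag_diag by (auto simp: mat_diag_def)
    then have SS: "?S * ?S = 1\<^sub>m n" by simp
    have "?S * ?T p * ?S = ?T (- p)"
    proof -
      have "?S * ?T p = mat n n (\<lambda>(i, j). (if i = k then -1 else 1) * ?T p $$ (i, j))"
        by (rule mat_diag_mult_left) simp
      then have "?S * ?T p * ?S =
          mat n n (\<lambda>(i, j). (?S * ?T p) $$ (i, j) * (if j = k then -1 else 1))"
        by (intro mat_diag_mult_right) simp
      then show ?thesis
        unfolding \<open>?S * ?T p = _\<close> using kl by auto
    qed
    then have "F (?T (- p)) = F (?S * ?T p * ?S)"
      by (simp only:)
    also have "\<dots> = F ?S * F (?T p) * F ?S"
      using mult[of "?S * ?T p" ?S] mult[of ?S "?T p"] mult_carrier_mat[of ?S n n "?T p" n] by simp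
    also have "\<dots> = F (?S * ?S) * F (?T p)"
      using mult[of ?S ?S] by simp
    finally have "F (?T (- p)) = F (?T p)"
      by (simp only: SS one mult_1)
    moreover have "F (?T p) * F (?T (- p)) = 1"
      by (subst mult[symmetric]) (simp_all add: addrow_mat_add kl addrow_mat_zero one)
    ultimately show ?thesis by (simp add: power2_eq_square)
  qed
  have "addrow_mat n q k l = addrow_mat n ((1/2) *\<^sub>R q) k l * addrow_mat n ((1/2) *\<^sub>R q) k l"
    by (simp add: addrow_mat_add kl scaleR_left_distrib[symmetric])
  then show ?thesis using square[of "(1/2) *\<^sub>R q"] by (simp add: mult power2_eq_square)
qed

lemma multiplicative_transvection_products:
  fixes F :: "'a :: ring_1 mat \<Rightarrow> 'b :: monoid_mult"
  assumes "T \<in> transvection_products n"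
    and G: "\<And>T. T \<in> transvection_products n \<Longrightarrow> T \<in> G"
    and mult: "\<And>A B. A \<in> G \<Longrightarrow> B \<in> G \<Longrightarrow> F (A * B) = F A * F B"
    and one: "F (1\<^sub>m n) = 1"
    and addrow: "\<And>q k l. k < n \<Longrightarrow> l < n \<Longrightarrow> k \<noteq> l \<Longrightarrow> F (addrow_mat n q k l) = 1"
  shows "F T = 1"
  using assms(1)
proof induction
  case (step T k l q)
  have "F (addrow_mat n q k l * T) = F (addrow_mat n q k l) * F T"
    using step.hyps by (intro mult G addrow_mat_in_transvection_products)
  then show ?case using addrow[OF step.hyps(2-4)] step.IH by simp
qed (rule one)

section \<open>The complex determinant of a quaternionic matrix\<close>

text \<open>A quaternion is \<open>a + b j\<close> with complex \<open>a\<close> and \<open>b\<close>; the two functions below extract \<open>a\<close> and \<open>b\<close>.\<close>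

definition complex_part1 :: "quat \<Rightarrow> complex" where
  "complex_part1 q = Complex (qRe q) (qI q)"

definition complex_part2 :: "quat \<Rightarrow> complex" where
  "complex_part2 q = Complex (qJ q) (qK q)"

lemma complex_part_sum:
  "complex_part1 (\<Sum>i\<in>S. f i) = (\<Sum>i\<in>S. complex_part1 (f i))"
  "complex_part2 (\<Sum>i\<in>S. f i) = (\<Sum>i\<in>S. complex_part2 (f i))"
  by (induction S rule: infinite_finite_induct)
    (auto simp: complex_part1_def complex_part2_def complex_eq_iff)

lemma complex_part_mult:
  "complex_part1 (p * q) =
    complex_part1 p * complex_part1 q + complex_part2 p * - cnj (complex_part2 q)"
  "complex_part2 (p * q) =
    complex_part1 p * complex_part2 q + complex_part2 p * cnj (complex_part1 q)"
  by (simp_all add: complex_part1_def complex_part2_def complex_eq_iff)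

text \<open>Entrywise this is the representation of \<open>a + b j\<close> by the complex matrix with rows \<open>(a, b)\<close> and
  \<open>(- cnj b, cnj a)\<close>, up to a permutation of the indices that collects equal positions into blocks.\<close>

definition complex_mat :: "quat mat \<Rightarrow> complex mat" where
  "complex_mat X = four_block_mat
    (map_mat complex_part1 X) (map_mat complex_part2 X)
    (map_mat (\<lambda>q. - cnj (complex_part2 q)) X) (map_mat (\<lambda>q. cnj (complex_part1 q)) X)"

lemma complex_mat_carrier:
  "X \<in> carrier_mat n n \<Longrightarrow> complex_mat X \<in> carrier_mat (n + n) (n + n)"
  unfolding complex_mat_def by (intro four_block_carrier_mat) auto

lemma complex_mat_mult:
  assumes X: "X \<in> carrier_mat n n" and Y: "Y \<in> carrier_mat n n"
  shows "complex_mat (X * Y) = complex_mat X * complex_mat Y"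
proof -
  let ?A = "map_mat complex_part1" and ?B = "map_mat complex_part2"
    and ?C = "map_mat (\<lambda>q. - cnj (complex_part2 q))" and ?D = "map_mat (\<lambda>q. cnj (complex_part1 q))"
  note simps = scalar_prod_def complex_part_sum complex_part_mult sum.distrib[symmetric]
    sum_negf[symmetric]
  have "complex_mat X * complex_mat Y = four_block_mat
      (?A X * ?A Y + ?B X * ?C Y) (?A X * ?B Y + ?B X * ?D Y)
      (?C X * ?A Y + ?D X * ?C Y) (?C X * ?B Y + ?D X * ?D Y)"
    unfolding complex_mat_def using X Y
    by (intro mult_four_block_mat[of _ n n _ n _ n _ _ n _ n]) auto
  moreover have "?A (X * Y) = ?A X * ?A Y + ?B X * ?C Y" "?B (X * Y) = ?A X * ?B Y + ?B X * ?D Y"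
    "?C (X * Y) = ?C X * ?A Y + ?D X * ?C Y" "?D (X * Y) = ?C X * ?B Y + ?D X * ?D Y"
    using X Y by (auto simp: simps algebra_simps intro!: sum.cong)
  ultimately show ?thesis by (simp only: complex_mat_def)
qed

text \<open>The root compensates for the doubling of the size: a real matrix occurs twice in its complex form,
  and the determinant of a single quaternion is its squared norm.\<close>

definition norm_det :: "quat mat \<Rightarrow> real" where
  "norm_det X = sqrt (cmod (det (complex_mat X)))"

lemma norm_det_nonneg: "norm_det X \<ge> 0"
  by (simp add: norm_det_def)

lemma norm_det_mult:
  assumes "X \<in> carrier_mat n n" "Y \<in> carrier_mat n n"
  shows "norm_det (X * Y) = norm_det X * norm_det Y"
  using assms
  by (simp add: norm_det_def complex_mat_mult norm_mult real_sqrt_mult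
      det_mult[OF complex_mat_carrier complex_mat_carrier])

lemma norm_det_of_real:
  assumes Y: "Y \<in> carrier_mat n n"
  shows "norm_det (map_mat of_real Y) = \<bar>det Y\<bar>"
proof -
  have parts: "complex_part1 (of_real t) = of_real t" "complex_part2 (of_real t) = 0" for t
    by (simp_all add: complex_part1_def complex_part2_def complex_eq_iff)
  have "complex_mat (map_mat of_real Y) =
      four_block_mat (map_mat of_real Y) (0\<^sub>m n n) (0\<^sub>m n n) (map_mat of_real Y)"
    unfolding complex_mat_def using Y by (intro arg_cong4[of _ _ _ _ _ _ _ _ four_block_mat])
      (auto simp: parts)
  then have "det (complex_mat (map_mat of_real Y)) = of_real (det Y) * of_real (det Y)"
    using Y det_four_block_mat_lower_left_zero[of "map_mat of_real Y :: complex mat" n "0\<^sub>m n n" n]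
    by (simp add: of_real_hom.hom_det)
  then show ?thesis by (simp add: norm_det_def norm_mult)
qed

lemma norm_det_one: "norm_det (1\<^sub>m n) = 1"
proof -
  have "map_mat of_real (1\<^sub>m n :: real mat) = (1\<^sub>m n :: quat mat)"
    by auto
  then show ?thesis using norm_det_of_real[of "1\<^sub>m n" n] by simp
qed

lemma norm_det_addrow_mat:
  "k < n \<Longrightarrow> l < n \<Longrightarrow> k \<noteq> l \<Longrightarrow> norm_det (addrow_mat n q k l) = 1"
  by (rule multiplicative_addrow_mat[where F = norm_det]) (simp_all add: norm_det_mult norm_det_one)

lemma det_mat_diag: "det (mat_diag n d) = (\<Prod>i<n. d i)"
proof -
  have "det (mat_diag n d) = prod_list (diag_mat (mat_diag n d))"
    by (rule det_upper_triangular) (auto simp: mat_diag_def)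
  also have "diag_mat (mat_diag n d) = map d [0..<n]"
    by (auto simp: diag_mat_def mat_diag_def)
  finally show ?thesis
    by (simp add: prod.distinct_set_conv_list[symmetric] atLeast0LessThan)
qed

text \<open>A purely imaginary \<open>u\<close> orthogonal to the imaginary part of \<open>q\<close> anticommutes with that part and hence
  conjugates \<open>q\<close> to \<open>qcnj q\<close>.\<close>

lemma quat_conjugate_qcnj: "\<exists>u. u \<noteq> 0 \<and> u * q = qcnj q * u"
proof (cases "qI q = 0 \<and> qJ q = 0")
  case True
  \<comment> \<open>Here the imaginary part is a multiple of \<open>k\<close>, and \<open>i\<close> is orthogonal to it.\<close>
  then show ?thesis by (intro exI[of _ qi]) (auto simp: qi_def qcnj_def quat_eq_iff)
next
  case False
  then show ?thesis
    by (intro exI[of _ "Quat 0 (- qJ q) (qI q) 0"]) (auto simp: qcnj_def quat_eq_iff algebra_simps)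
qed

text \<open>Since \<open>q\<close> and its conjugate are conjugate in the multiplicative group, they contribute the same value,
  whose square is the value at the real number \<open>(norm q)\<^sup>2\<close>; there the determinant is a real one.\<close>

lemma norm_det_single:
  assumes "0 < n"
  shows "norm_det (mat_diag n (\<lambda>i. if i = 0 then q else 1)) = norm q"
proof -
  define E where "E q = mat_diag n (\<lambda>i. if i = 0 then q else 1)" for q :: quat
  have mult: "norm_det (E (p * q)) = norm_det (E p) * norm_det (E q)" for p q
  proof -
    have "E (p * q) = E p * E q"
      unfolding E_def mat_diag_diag by (auto simp: mat_diag_def)
    then show ?thesis using norm_det_mult[of "E p" n "E q"] by (simp add: E_def)
  qed
  obtain u where u: "u \<noteq> 0" "u * q = qcnj q * u"
    using quat_conjugate_qcnj by blast
  have "E 1 = 1\<^sub>m n"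
    unfolding E_def by (auto simp: mat_diag_def)
  then have "norm_det (E u) * norm_det (E (inverse u)) = 1"
    using u(1) by (simp add: mult[symmetric] norm_det_one)
  moreover have "norm_det (E u) * norm_det (E q) = norm_det (E (qcnj q)) * norm_det (E u)"
    by (simp only: mult[symmetric] u(2))
  ultimately have "norm_det (E (qcnj q)) = norm_det (E q)"
    by auto
  then have "(norm_det (E q))\<^sup>2 = norm_det (E (of_real ((norm q)\<^sup>2)))"
    using mult[of q "qcnj q"] quat_mult_cnj(1)[of q]
    by (simp add: power2_eq_square of_real_def)
  also have "E (of_real ((norm q)\<^sup>2)) =
      map_mat of_real (mat_diag n (\<lambda>i. if i = 0 then (norm q)\<^sup>2 else 1))"
    unfolding E_def by (auto simp: mat_diag_def)
  also have "norm_det \<dots> = (norm q)\<^sup>2"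
    using assms by (simp add: norm_det_of_real[of _ n] det_mat_diag prod.delta)
  finally show ?thesis
    unfolding E_def using norm_det_nonneg power2_eq_iff_nonneg by (metis norm_ge_zero)
qed

section \<open>Uniqueness of the Dieudonne determinant\<close>

lemma GL_iff:
  "A \<in> GL n \<longleftrightarrow> A \<in> carrier_mat n n \<and> (\<exists>B\<in>carrier_mat n n. A * B = 1\<^sub>m n \<and> B * A = 1\<^sub>m n)"
proof
  assume "A \<in> GL n"
  then obtain B where A: "A \<in> carrier_mat n n" and B: "A * B = 1\<^sub>m n" "B * A = 1\<^sub>m (dim_row B)"
    by (auto simp: GL_def invertible_mat_def inverts_mat_def)
  have "dim_col B = n" "dim_row B = n"
    using arg_cong[OF B(1), of dim_col] arg_cong[OF B(2), of dim_col] A by auto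
  then show "A \<in> carrier_mat n n \<and> (\<exists>B\<in>carrier_mat n n. A * B = 1\<^sub>m n \<and> B * A = 1\<^sub>m n)"
    using A B by (intro conjI bexI[of _ B]) auto
qed (auto simp: GL_def invertible_mat_def inverts_mat_def)

lemma GL_carrier: "A \<in> GL n \<Longrightarrow> A \<in> carrier_mat n n"
  by (simp add: GL_def)

lemma GL_mult:
  assumes "A \<in> GL n" "B \<in> GL n"
  shows "A * B \<in> GL n"
proof -
  obtain A' B' where *: "A' \<in> carrier_mat n n" "A * A' = 1\<^sub>m n" "A' * A = 1\<^sub>m n"
    "B' \<in> carrier_mat n n" "B * B' = 1\<^sub>m n" "B' * B = 1\<^sub>m n"
    using assms unfolding GL_iff by blast
  note c = assms[THEN GL_carrier] *(1,4)
  have "A * B * (B' * A') = A * (B * B' * A')" "B' * A' * (A * B) = B' * (A' * A * B)"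
    using c by (simp_all add: assoc_mult_mat[of _ n n _ n _ n] mult_carrier_mat[of _ n n _ n])
  then have "A * B * (B' * A') = 1\<^sub>m n" "B' * A' * (A * B) = 1\<^sub>m n"
    using c * by simp_all
  moreover have "A * B \<in> carrier_mat n n" "B' * A' \<in> carrier_mat n n"
    using c by (auto intro: mult_carrier_mat[of _ n n _ n])
  ultimately show ?thesis
    unfolding GL_iff by blast
qed

lemma one_mat_GL: "1\<^sub>m n \<in> GL n"
  unfolding GL_iff by (auto intro!: bexI[of _ "1\<^sub>m n"])

lemma transvection_products_GL:
  assumes "T \<in> transvection_products n"
  shows "T \<in> GL n"
  using assms
proof induction
  case (step T k l q)
  have "addrow_mat n q k l * addrow_mat n (- q) k l = 1\<^sub>m n"
    "addrow_mat n (- q) k l * addrow_mat n q k l = 1\<^sub>m n"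
    using step.hyps by (simp_all add: addrow_mat_add addrow_mat_zero)
  then have "addrow_mat n q k l \<in> GL n"
    unfolding GL_iff by auto
  then show ?case using step.IH by (rule GL_mult)
qed (rule one_mat_GL)

lemma mat_diag_GL_iff: "mat_diag n d \<in> GL n \<longleftrightarrow> (\<forall>i<n. d i \<noteq> 0)"
proof
  assume "mat_diag n d \<in> GL n"
  then obtain B where B: "B \<in> carrier_mat n n" "mat_diag n d * B = 1\<^sub>m n"
    unfolding GL_iff by blast
  show "\<forall>i<n. d i \<noteq> 0"
  proof (intro allI impI notI)
    fix i assume "i < n" "d i = 0"
    then have "(mat_diag n d * B) $$ (i, i) = 0"
      using B(1) by (subst mat_diag_mult_left[OF B(1)]) simp
    with B(2) \<open>i < n\<close> show False by simp
  qed
next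
  assume "\<forall>i<n. d i \<noteq> 0"
  then have "mat_diag n (\<lambda>i. d i * inverse (d i)) = 1\<^sub>m n"
    "mat_diag n (\<lambda>i. inverse (d i) * d i) = 1\<^sub>m n"
    by (auto simp: mat_diag_def)
  then show "mat_diag n d \<in> GL n"
    unfolding GL_iff by (auto intro!: bexI[of _ "mat_diag n (\<lambda>i. inverse (d i))"])
qed

text \<open>The normalization prescribes the value only when \<open>q\<close> is in the first place; a permutation matrix
  conjugates the other places to the first, and the positive reals commute.\<close>

lemma dieudonne_hom_single:
  assumes F: "is_dieudonne_hom n F" and "m < n" "q \<noteq> 0"
  shows "F (mat_diag n (\<lambda>i. if i = m then q else 1)) = norm q"
proof -
  let ?P = "swaprows_mat n 0 m :: quat mat"
  let ?E = "\<lambda>m. mat_diag n (\<lambda>i. if i = m then q else 1)"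
  have P: "?P \<in> GL n"
    unfolding GL_iff using assms swaprows_mat_inv[of 0 n m] by auto
  have E: "?E m \<in> GL n" "?E 0 \<in> GL n"
    using assms by (simp_all add: mat_diag_GL_iff)
  have "?P * ?E m = mat n n (\<lambda>(i, j). ?P $$ (i, j) * (if j = m then q else 1))"
    by (rule mat_diag_mult_right) simp
  moreover have "?E 0 * ?P = mat n n (\<lambda>(i, j). (if i = 0 then q else 1) * ?P $$ (i, j))"
    by (rule mat_diag_mult_left) simp
  ultimately have "?P * ?E m = ?E 0 * ?P"
    using assms by auto
  then have "F ?P * F (?E m) = F (?E 0) * F ?P"
    using F P E unfolding is_dieudonne_hom_def by metis
  moreover have "F ?P > 0"
    using F P unfolding is_dieudonne_hom_def by auto
  moreover have "F (?E 0) = norm q"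
    using F assms unfolding is_dieudonne_hom_def by auto
  ultimately show ?thesis by simp
qed

lemma dieudonne_hom_one:
  assumes F: "is_dieudonne_hom n F"
  shows "F (1\<^sub>m n) = 1"
proof -
  have "F (1\<^sub>m n * 1\<^sub>m n) = F (1\<^sub>m n) * F (1\<^sub>m n)"
    using F one_mat_GL[of n] unfolding is_dieudonne_hom_def by blast
  then have "F (1\<^sub>m n) * F (1\<^sub>m n) = F (1\<^sub>m n)"
    by simp
  moreover have "F (1\<^sub>m n) > 0"
    using F one_mat_GL[of n] unfolding is_dieudonne_hom_def by auto
  ultimately show ?thesis by simp
qed

lemma dieudonne_hom_mat_diag:
  assumes F: "is_dieudonne_hom n F" and d: "\<forall>i<n. d i \<noteq> 0"
  shows "F (mat_diag n d) = (\<Prod>i<n. norm (d i))"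
proof -
  have "F (mat_diag n (\<lambda>i. if i < m then d i else 1)) = (\<Prod>i<m. norm (d i))" if "m \<le> n" for m
    using that
  proof (induction m)
    case 0
    then show ?case using dieudonne_hom_one[OF F] by simp
  next
    case (Suc m)
    let ?D = "mat_diag n (\<lambda>i. if i < m then d i else 1)"
      and ?E = "mat_diag n (\<lambda>i. if i = m then d m else 1)"
    have "mat_diag n (\<lambda>i. if i < Suc m then d i else 1) = ?D * ?E"
      unfolding mat_diag_diag by (auto simp: mat_diag_def)
    moreover have "?D \<in> GL n" "?E \<in> GL n"
      using Suc.prems d by (simp_all add: mat_diag_GL_iff)
    ultimately have "F (mat_diag n (\<lambda>i. if i < Suc m then d i else 1)) = F ?D * F ?E"
      using F unfolding is_dieudonne_hom_def by (simp del: mat_diag_diag)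
    then show ?case
      using Suc dieudonne_hom_single[OF F, of m "d m"] d by simp
  qed
  moreover have "mat_diag n (\<lambda>i. if i < n then d i else 1) = mat_diag n d"
    by (auto simp: mat_diag_def)
  ultimately show ?thesis by (metis le_refl)
qed

text \<open>Diagonalization by transvections does not change the value of a Dieudonne homomorphism, and both of them
  take the product of the norms on the diagonal matrix reached.\<close>

lemma dieudonne_hom_unique:
  assumes F: "is_dieudonne_hom n F" and F': "is_dieudonne_hom n F'" and A: "A \<in> GL n"
  shows "F A = F' A"
proof -
  obtain d S T where S: "S \<in> transvection_products n" and T: "T \<in> transvection_products n"
    and eq: "mat_diag n d = S * A * T"
    using transvection_equiv_diagonal[OF GL_carrier[OF A]] unfolding transvection_equiv_def by blast
  have "mat_diag n d \<in> GL n"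
    unfolding eq using GL_mult transvection_products_GL[OF S] A transvection_products_GL[OF T] by blast
  then have d: "\<forall>i<n. d i \<noteq> 0" by (simp add: mat_diag_GL_iff)
  have "H A = (\<Prod>i<n. norm (d i))" if H: "is_dieudonne_hom n H" for H
  proof -
    have mult: "\<And>A B. A \<in> GL n \<Longrightarrow> B \<in> GL n \<Longrightarrow> H (A * B) = H A * H B"
      and addrow: "\<And>q k l. k < n \<Longrightarrow> l < n \<Longrightarrow> k \<noteq> l \<Longrightarrow> H (addrow_mat n q k l) = 1"
      using H unfolding is_dieudonne_hom_def by blast+
    have "H U = 1" if U: "U \<in> transvection_products n" for U
      by (rule multiplicative_transvection_products[OF U transvection_products_GL mult
            dieudonne_hom_one[OF H] addrow])
    then have "H (mat_diag n d) = H A"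
      unfolding eq using A S T GL_mult[of S n A] by (simp add: mult transvection_products_GL)
    then show ?thesis using dieudonne_hom_mat_diag[OF H d] by simp
  qed
  from this[OF F] this[OF F'] show ?thesis by simp
qed

lemma is_dieudonne_hom_norm_det: "is_dieudonne_hom n (restrict norm_det (GL n))"
proof -
  have pos: "norm_det A > 0" if A: "A \<in> GL n" for A
  proof -
    obtain B where "B \<in> carrier_mat n n" "A * B = 1\<^sub>m n" using A unfolding GL_iff by blast
    then have "norm_det A * norm_det B = 1"
      using norm_det_mult[OF GL_carrier[OF A], of B] norm_det_one by simp
    then show ?thesis using norm_det_nonneg[of A] by (cases "norm_det A = 0") auto
  qed
  show ?thesis
    unfolding is_dieudonne_hom_def
  proof (intro conjI ballI allI impI)
    show "restrict norm_det (GL n) \<in> GL n \<rightarrow>\<^sub>E {0<..}"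
      using pos by simp
  next
    fix A B assume "A \<in> GL n" "B \<in> GL n"
    then show "restrict norm_det (GL n) (A * B) =
        restrict norm_det (GL n) A * restrict norm_det (GL n) B"
      using norm_det_mult[OF GL_carrier GL_carrier] GL_mult by simp
  next
    fix q k l assume "k < n" "l < n" "k \<noteq> l"
    moreover from this have "addrow_mat n q k l \<in> GL n"
      by (intro transvection_products_GL addrow_mat_in_transvection_products)
    ultimately show "restrict norm_det (GL n) (addrow_mat n q k l) = 1"
      by (simp add: norm_det_addrow_mat)
  next
    fix q :: quat assume "0 < n" "q \<noteq> 0"
    then show "restrict norm_det (GL n) (mat_diag n (\<lambda>i. if i = 0 then q else 1)) = norm q"
      by (simp add: norm_det_single mat_diag_GL_iff)
  qed
qed

theorem dieudonne_det_eq_norm_det: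
  assumes "X \<in> GL n"
  shows "dieudonne_det X = norm_det X"
proof -
  have "(THE F. is_dieudonne_hom n F) = restrict norm_det (GL n)"
  proof (rule the_equality)
    fix F assume F: "is_dieudonne_hom n F"
    show "F = restrict norm_det (GL n)"
    proof (rule PiE_ext)
      show "F \<in> GL n \<rightarrow>\<^sub>E {0<..}" "restrict norm_det (GL n) \<in> GL n \<rightarrow>\<^sub>E {0<..}"
        by (rule conjunct1[OF F[unfolded is_dieudonne_hom_def]]
            conjunct1[OF is_dieudonne_hom_norm_det[unfolded is_dieudonne_hom_def]])+
    qed (rule dieudonne_hom_unique[OF F is_dieudonne_hom_norm_det])
  qed (rule is_dieudonne_hom_norm_det)
  then show ?thesis
    using assms GL_carrier[OF assms] by (auto simp: dieudonne_det_def GL_def)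
qed

section \<open>Block triangular determinants\<close>

text \<open>The number of the block that contains row or column \<open>i\<close>. With it, conditions on blocks become
  conditions on single entries.\<close>

fun block_index :: "nat list \<Rightarrow> nat \<Rightarrow> nat" where
  "block_index [] i = 0"
| "block_index (a # r) i = (if i < a then 0 else Suc (block_index r (i - a)))"

lemma block_index_offset:
  assumes "k < length r" "a < r ! k"
  shows "block_index r (sum_list (take k r) + a) = k" "sum_list (take k r) + a < sum_list r"
  using assms by (induction r arbitrary: k) (auto simp: nth_Cons take_Cons split: nat.splits)

lemma block_index_decompose:
  assumes "i < sum_list r"
  obtains a where "block_index r i < length r" "a < r ! block_index r i"
    "i = sum_list (take (block_index r i) r) + a"
proof -
  have "\<exists>a. block_index r i < length r \<and> a < r ! block_index r i \<and>
      i = sum_list (take (block_index r i) r) + a"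
    using assms
  proof (induction r arbitrary: i)
    case (Cons b r)
    show ?case
    proof (cases "i < b")
      case False
      with Cons.prems have "i - b < sum_list r" by auto
      from Cons.IH[OF this] False show ?thesis by auto
    qed auto
  qed simp
  then show ?thesis using that by blast
qed

lemma block_index_less: "i < sum_list r \<Longrightarrow> block_index r i < length r"
  by (erule block_index_decompose)

lemma block_carrier: "block r X k u \<in> carrier_mat (r ! k) (r ! u)"
  by (simp add: block_def)

lemma block_eq_zero_iff:
  assumes "k < length r" "u < length r"
  shows "block r X k u = 0\<^sub>m (r ! k) (r ! u) \<longleftrightarrow>
    (\<forall>i<sum_list r. \<forall>j<sum_list r. block_index r i = k \<longrightarrow> block_index r j = u \<longrightarrow> X $$ (i, j) = 0)"
    (is "?L \<longleftrightarrow> ?R")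
proof
  assume L: ?L
  show ?R
  proof (intro allI impI)
    fix i j assume ij: "i < sum_list r" "j < sum_list r" "block_index r i = k" "block_index r j = u"
    obtain a where a: "a < r ! k" "i = sum_list (take k r) + a"
      using block_index_decompose[OF ij(1)] ij(3) by metis
    obtain b where b: "b < r ! u" "j = sum_list (take u r) + b"
      using block_index_decompose[OF ij(2)] ij(4) by metis
    have "block r X k u $$ (a, b) = 0" using L a b by simp
    then show "X $$ (i, j) = 0" using a b by (simp add: block_def)
  qed
next
  assume ?R
  then show ?L
    using block_index_offset assms by (auto simp: block_def)
qed

text \<open>Splitting off the first block row and column leaves a matrix with the block sizes of the tail of \<open>r\<close>,
  so the two-by-two block formula for determinants can be iterated.\<close>

theorem det_block_upper:
  fixes Y :: "'a :: idom mat"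
  assumes "Y \<in> carrier_mat (sum_list r) (sum_list r)"
    and "\<And>k u. k < length r \<Longrightarrow> u < k \<Longrightarrow> block r Y k u = 0\<^sub>m (r ! k) (r ! u)"
  shows "det Y = (\<Prod>k<length r. det (block r Y k k))"
  using assms
proof (induction r arbitrary: Y)
  case (Cons a r)
  let ?n = "sum_list r"
  obtain A B C D where split: "split_block Y a a = (A, B, C, D)"
    by (cases "split_block Y a a")
  have dims: "dim_row Y = a + ?n" "dim_col Y = a + ?n"
    using Cons.prems(1) by auto
  note s = split_block[OF split dims]
  have AD: "A = mat a a (\<lambda>ij. Y $$ ij)" "C = mat ?n a (\<lambda>(i, j). Y $$ (i + a, j))"
    "D = mat ?n ?n (\<lambda>(i, j). Y $$ (i + a, j + a))"
    using split dims by (auto simp: split_block_def Let_def)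
  have "Y $$ (i + a, j) = 0" if ij: "i < ?n" "j < a" for i j
  proof -
    let ?k = "Suc (block_index r i)"
    have "?k < length (a # r)" using block_index_less[OF ij(1)] by simp
    then have "block (a # r) Y ?k 0 = 0\<^sub>m ((a # r) ! ?k) ((a # r) ! 0)"
      by (intro Cons.prems(2)) auto
    then show ?thesis
      using block_eq_zero_iff[of ?k "a # r" 0 Y] \<open>?k < _\<close> ij by force
  qed
  then have C: "C = 0\<^sub>m ?n a"
    by (auto simp: AD)
  have D: "block r D k u = block (a # r) Y (Suc k) (Suc u)" if "k < length r" "u < length r" for k u
    using block_index_offset(2)[of _ r] that by (auto simp: block_def AD ac_simps)
  have "det Y = det A * det D"
    using s C by (simp add: det_four_block_mat_lower_left_zero)
  also have "det D = (\<Prod>k<length r. det (block r D k k))"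
    using Cons.prems(2) s(4) by (intro Cons.IH) (auto simp: D)
  also have "\<dots> = (\<Prod>k<length r. det (block (a # r) Y (Suc k) (Suc k)))"
    by (simp add: D)
  also have "A = block (a # r) Y 0 0"
    by (auto simp: block_def AD)
  finally show ?case
    by (simp add: prod.lessThan_Suc_shift del: prod.lessThan_Suc)
qed simp

lemma block_transpose:
  assumes "Y \<in> carrier_mat (sum_list r) (sum_list r)" "k < length r" "u < length r"
  shows "block r (transpose_mat Y) k u = transpose_mat (block r Y u k)"
  using assms block_index_offset(2) by (auto simp: block_def)

lemma det_block_lower:
  fixes Y :: "'a :: idom mat"
  assumes Y: "Y \<in> carrier_mat (sum_list r) (sum_list r)"
    and zero: "\<And>k u. u < length r \<Longrightarrow> k < u \<Longrightarrow> block r Y k u = 0\<^sub>m (r ! k) (r ! u)"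
  shows "det Y = (\<Prod>k<length r. det (block r Y k k))"
proof -
  \<comment> \<open>Transposition exchanges lower and upper block triangular matrices.\<close>
  have "det (transpose_mat Y) = (\<Prod>k<length r. det (block r (transpose_mat Y) k k))"
    using Y by (intro det_block_upper) (auto simp: block_transpose zero)
  also have "\<dots> = (\<Prod>k<length r. det (block r Y k k))"
    by (rule prod.cong) (auto simp: block_transpose[OF Y] det_transpose[OF block_carrier])
  finally show ?thesis using Y by (simp add: det_transpose)
qed

section \<open>Degree-0 matrices as twisted real matrices\<close>

definition quat_basis :: "nat \<Rightarrow> quat" where
  "quat_basis k = [1, qi, qj, qk] ! k"

lemma less_4_cases: "k < 4 \<Longrightarrow> k = 0 \<or> k = 1 \<or> k = 2 \<or> k = (3 :: nat)"
  by auto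

lemma quat_basis_unitary:
  assumes "k < 4"
  shows "qcnj (quat_basis k) * quat_basis k = 1" "quat_basis k * qcnj (quat_basis k) = 1"
  using less_4_cases[OF assms]
  by (auto simp: quat_basis_def quat_eq_iff qi_def qj_def qk_def qcnj_def)

lemma quat_basis_hcomp:
  assumes "k < 4"
  shows "quat_basis k \<in> hcomp (gam k)" "qcnj (quat_basis k) \<in> hcomp (gam k)"
  using less_4_cases[OF assms]
  by (auto simp: quat_basis_def hcomp_def gam_def quat_eq_iff qi_def qj_def qk_def qcnj_def
      image_iff)

lemma of_real_hcomp: "of_real t \<in> hcomp (0, 0, 0)"
  by (simp add: hcomp_def of_real_def)

lemma hcomp_zero_eq: "q \<in> hcomp (0, 0, 0) \<Longrightarrow> q = of_real (qRe q)"
  by (auto simp: hcomp_def of_real_def)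

lemma homogeneous_in_hcomp:
  assumes "k < 4" "u < 4"
  shows "quat_basis k * of_real t * qcnj (quat_basis u) \<in> hcomp (gam k + gam u)"
  using hcomp_mult[OF hcomp_mult[OF quat_basis_hcomp(1)[OF assms(1)] of_real_hcomp[of t]]
      quat_basis_hcomp(2)[OF assms(2)]]
  by (simp flip: zero_prod_def)

text \<open>Multiplying \<open>q\<close> by units of degrees \<open>\<gamma>\<^sub>k\<close> and \<open>\<gamma>\<^sub>u\<close> on the two sides brings it to degree \<open>0\<close>,
  because every degree is its own negative. The result is the real coordinate of \<open>q\<close>.\<close>

lemma hcomp_homogeneous:
  assumes k: "k < 4" and u: "u < 4" and q: "q \<in> hcomp (gam k + gam u)"
  shows "quat_basis k * of_real (qRe (qcnj (quat_basis k) * q * quat_basis u)) *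
    qcnj (quat_basis u) = q"
proof -
  have self: "gam k + gam k = 0" for k
    by (cases "gam k") (auto simp: zero_prod_def)
  let ?p = "qcnj (quat_basis k) * q * quat_basis u"
  have "?p \<in> hcomp (gam k + (gam k + gam u) + gam u)"
    using k u q by (intro hcomp_mult quat_basis_hcomp)
  also have "gam k + (gam k + gam u) + gam u = (gam k + gam k) + (gam u + gam u)"
    by (simp only: add.assoc)
  also have "\<dots> = (0, 0, 0)"
    unfolding self by (simp add: zero_prod_def)
  finally have "of_real (qRe ?p) = ?p"
    by (rule hcomp_zero_eq[symmetric])
  then have "quat_basis k * of_real (qRe ?p) * qcnj (quat_basis u) =
      (quat_basis k * qcnj (quat_basis k)) * q * (quat_basis u * qcnj (quat_basis u))"
    by (simp only: mult.assoc)
  then show ?thesis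
    by (simp only: quat_basis_unitary k u mult_1_left mult_1_right)
qed

definition basis_diag :: "nat list \<Rightarrow> quat mat" where
  "basis_diag r = mat_diag (sum_list r) (\<lambda>i. quat_basis (block_index r i))"

definition basis_diag_inv :: "nat list \<Rightarrow> quat mat" where
  "basis_diag_inv r = mat_diag (sum_list r) (\<lambda>i. qcnj (quat_basis (block_index r i)))"

text \<open>Conjugation by the diagonal matrix of homogeneous units, which maps the real matrices of size
  \<open>sum_list r\<close> isomorphically onto \<open>M0 r\<close>; \<open>untwist\<close> is the inverse map, entry by entry.\<close>

definition twist :: "nat list \<Rightarrow> real mat \<Rightarrow> quat mat" where
  "twist r Y = basis_diag r * map_mat of_real Y * basis_diag_inv r"

definition untwist :: "nat list \<Rightarrow> quat mat \<Rightarrow> real mat" where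
  "untwist r X = mat (sum_list r) (sum_list r) (\<lambda>(i, j).
     qRe (qcnj (quat_basis (block_index r i)) * X $$ (i, j) * quat_basis (block_index r j)))"

lemma basis_diag_carrier [simp]:
  "basis_diag r \<in> carrier_mat (sum_list r) (sum_list r)"
  "basis_diag_inv r \<in> carrier_mat (sum_list r) (sum_list r)"
  by (simp_all add: basis_diag_def basis_diag_inv_def)

lemma untwist_carrier [simp]: "untwist r X \<in> carrier_mat (sum_list r) (sum_list r)"
  by (simp add: untwist_def)

context
  fixes r :: "nat list"
  assumes r: "length r = 4"
begin

lemma block_index_less_4: "i < sum_list r \<Longrightarrow> block_index r i < 4"
  using block_index_less[of i r] r by simp

lemma basis_diag_inverse:
  "basis_diag_inv r * basis_diag r = 1\<^sub>m (sum_list r)"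
  "basis_diag r * basis_diag_inv r = 1\<^sub>m (sum_list r)"
  unfolding basis_diag_def basis_diag_inv_def mat_diag_diag
  by (auto simp: mat_diag_def quat_basis_unitary block_index_less_4)

lemma twist_eq:
  assumes "Y \<in> carrier_mat (sum_list r) (sum_list r)"
  shows "twist r Y = mat (sum_list r) (sum_list r) (\<lambda>(i, j).
    quat_basis (block_index r i) * of_real (Y $$ (i, j)) * qcnj (quat_basis (block_index r j)))"
proof -
  let ?n = "sum_list r"
  have "basis_diag r * map_mat of_real Y =
      mat ?n ?n (\<lambda>(i, j). quat_basis (block_index r i) * map_mat of_real Y $$ (i, j))"
    unfolding basis_diag_def using assms by (intro mat_diag_mult_left) auto
  then have "twist r Y =
      mat ?n ?n (\<lambda>(i, j). (basis_diag r * map_mat of_real Y) $$ (i, j) *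
        qcnj (quat_basis (block_index r j)))"
    unfolding twist_def basis_diag_inv_def by (intro mat_diag_mult_right) auto
  then show ?thesis
    unfolding \<open>basis_diag r * map_mat of_real Y = _\<close> using assms by auto
qed

lemma twist_mult:
  assumes "Y \<in> carrier_mat (sum_list r) (sum_list r)" "Z \<in> carrier_mat (sum_list r) (sum_list r)"
  shows "twist r (Y * Z) = twist r Y * twist r Z"
proof -
  let ?n = "sum_list r" and ?E = "basis_diag r" and ?E' = "basis_diag_inv r"
  let ?Y = "map_mat of_real Y :: quat mat" and ?Z = "map_mat of_real Z :: quat mat"
  have YZ: "?Y \<in> carrier_mat ?n ?n" "?Z \<in> carrier_mat ?n ?n" using assms by auto
  note simps = assoc_mult_mat[of _ ?n ?n _ ?n _ ?n] mult_carrier_mat[of _ ?n ?n _ ?n]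
  have "twist r Y * twist r Z = ?E * ?Y * (?E' * ?E) * (?Z * ?E')"
    unfolding twist_def using YZ by (simp add: simps)
  also have "\<dots> = ?E * (?Y * ?Z) * ?E'"
    unfolding basis_diag_inverse using YZ by (simp add: simps right_mult_one_mat[of _ ?n ?n])
  also have "?Y * ?Z = map_mat of_real (Y * Z)"
    using assms by (auto simp: scalar_prod_def of_real_sum)
  finally show ?thesis by (simp add: twist_def)
qed

lemma twist_one: "twist r (1\<^sub>m (sum_list r)) = 1\<^sub>m (sum_list r)"
  by (subst twist_eq) (auto simp: quat_basis_unitary block_index_less_4)

lemma untwist_twist:
  assumes "Y \<in> carrier_mat (sum_list r) (sum_list r)"
  shows "untwist r (twist r Y) = Y"
proof -
  have "qRe (qcnj (quat_basis k) * (quat_basis k * of_real t * qcnj (quat_basis u)) * quat_basis u) = t"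
    if "k < 4" "u < 4" for k u t
  proof -
    have "qcnj (quat_basis k) * (quat_basis k * of_real t * qcnj (quat_basis u)) * quat_basis u =
        (qcnj (quat_basis k) * quat_basis k) * of_real t * (qcnj (quat_basis u) * quat_basis u)"
      by (simp only: mult.assoc)
    then show ?thesis using that by (simp add: quat_basis_unitary)
  qed
  then show ?thesis
    using assms by (auto simp: untwist_def twist_eq[OF assms] block_index_less_4)
qed

lemma twist_in_M0:
  assumes "Y \<in> carrier_mat (sum_list r) (sum_list r)"
  shows "twist r Y \<in> M0 r"
  unfolding M0_def
proof (intro CollectI conjI allI impI subsetI)
  show "twist r Y \<in> carrier_mat (sum_list r) (sum_list r)"
    by (simp add: twist_eq[OF assms])
  fix k u q assume ku: "k < 4" "u < 4" and "q \<in> elements_mat (block r (twist r Y) k u)"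
  then obtain a b where "a < r ! k" "b < r ! u"
    "q = twist r Y $$ (sum_list (take k r) + a, sum_list (take u r) + b)"
    by (auto simp: block_def)
  then show "q \<in> hcomp (gam k + gam u)"
    using ku r block_index_offset homogeneous_in_hcomp by (simp add: twist_eq[OF assms])
qed

lemma twist_untwist:
  assumes X: "X \<in> M0 r"
  shows "twist r (untwist r X) = X"
proof -
  have homogeneous: "X $$ (i, j) \<in> hcomp (gam (block_index r i) + gam (block_index r j))"
    if ij: "i < sum_list r" "j < sum_list r" for i j
  proof -
    let ?k = "block_index r i" and ?u = "block_index r j"
    obtain a where a: "a < r ! ?k" "i = sum_list (take ?k r) + a"
      using block_index_decompose[OF ij(1)] by metis
    obtain b where b: "b < r ! ?u" "j = sum_list (take ?u r) + b"
      using block_index_decompose[OF ij(2)] by metis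
    have "block r X ?k ?u $$ (a, b) = X $$ (i, j)"
      using a b by (simp add: block_def)
    then have "X $$ (i, j) \<in> elements_mat (block r X ?k ?u)"
      using a(1) b(1) elements_matI[OF block_carrier] by metis
    then show ?thesis using X block_index_less_4 ij by (auto simp: M0_def)
  qed
  have X': "X \<in> carrier_mat (sum_list r) (sum_list r)"
    using X by (simp add: M0_def)
  show ?thesis
  proof (rule eq_matI)
    fix i j assume "i < dim_row X" "j < dim_col X"
    then have ij: "i < sum_list r" "j < sum_list r" using X' by auto
    show "twist r (untwist r X) $$ (i, j) = X $$ (i, j)"
      using ij hcomp_homogeneous[OF block_index_less_4 block_index_less_4 homogeneous, OF ij ij]
      unfolding twist_eq[OF untwist_carrier] by (simp add: untwist_def del: quat_sel)
  qed (use X' in \<open>auto simp: twist_eq[OF untwist_carrier]\<close>)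
qed

lemma M0_mult: "X \<in> M0 r \<Longrightarrow> Z \<in> M0 r \<Longrightarrow> X * Z \<in> M0 r"
  using twist_in_M0[of "untwist r X * untwist r Z"] twist_mult[of "untwist r X" "untwist r Z"]
    mult_carrier_mat[OF untwist_carrier untwist_carrier, of r X Z]
  by (simp add: twist_untwist)

lemma untwist_mult:
  "X \<in> M0 r \<Longrightarrow> Z \<in> M0 r \<Longrightarrow> untwist r (X * Z) = untwist r X * untwist r Z"
  using untwist_twist[of "untwist r X * untwist r Z"] twist_mult[of "untwist r X" "untwist r Z"]
    mult_carrier_mat[OF untwist_carrier untwist_carrier, of r X Z]
  by (simp add: twist_untwist)

lemma untwist_diagonal_block:
  assumes "k < 4"
  shows "block r (untwist r X) k k = map_mat qRe (block r X k k)"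
proof -
  have "qRe (qcnj (quat_basis k) * q * quat_basis k) = qRe q" for q
    using less_4_cases[OF assms]
    by (auto simp: quat_basis_def qi_def qj_def qk_def qcnj_def)
  then show ?thesis
    using assms r block_index_offset by (auto simp: block_def untwist_def)
qed

lemma untwist_zero_block:
  assumes "k < 4" "u < 4" "block r X k u = 0\<^sub>m (r ! k) (r ! u)"
  shows "block r (untwist r X) k u = 0\<^sub>m (r ! k) (r ! u)"
  using assms r by (simp add: block_eq_zero_iff) (simp add: untwist_def)

lemma det_untwist_block_triangular:
  assumes "block_upper r X \<or> block_lower r X"
  shows "det (untwist r X) = (\<Prod>k<4. det (map_mat qRe (block r X k k)))"
proof -
  have "det (untwist r X) = (\<Prod>k<length r. det (block r (untwist r X) k k))"
    using assms
  proof
    assume "block_upper r X"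
    then show ?thesis
      by (intro det_block_upper) (auto simp: r block_upper_def intro!: untwist_zero_block)
  next
    assume "block_lower r X"
    then show ?thesis
      by (intro det_block_lower) (auto simp: r block_lower_def intro!: untwist_zero_block)
  qed
  then show ?thesis by (simp add: r untwist_diagonal_block)
qed

section \<open>The graded determinant as a real determinant\<close>

lemma is_graded_det_untwist:
  "is_graded_det r (\<lambda>X\<in>M0 r. of_real (det (untwist r X)))"
proof -
  have mult: "det (untwist r (X * Z)) = det (untwist r X) * det (untwist r Z)"
    if "X \<in> M0 r" "Z \<in> M0 r" for X Z
    using that by (simp add: untwist_mult det_mult[of _ "sum_list r"])
  have uni: "det (untwist r X) = 1" if "block_unitriangular r X" for X
  proof -
    have "map_mat qRe (1\<^sub>m n :: quat mat) = 1\<^sub>m n" for n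
      by auto
    then show ?thesis
      using that det_untwist_block_triangular[of X] by (simp add: block_unitriangular_def)
  qed
  show ?thesis
    unfolding is_graded_det_def
    by (auto simp: of_real_hcomp M0_mult mult uni block_diagonal_def det_untwist_block_triangular)
qed

text \<open>Transported to real matrices, \<open>F\<close> becomes a real-valued multiplicative function \<open>G\<close>. It takes the value
  \<open>1\<close> on transvections, like \<open>det\<close>, and agrees with \<open>det\<close> on diagonal matrices because the block-diagonal
  formula fixes it there; diagonalization spreads the agreement to all matrices.\<close>

lemma graded_det_unique:
  assumes F: "is_graded_det r F" and X: "X \<in> M0 r"
  shows "F X = of_real (det (untwist r X))"
proof -
  let ?n = "sum_list r"
  define G where "G Y = qRe (F (twist r Y))" for Y
  have FG: "F (twist r Y) = of_real (G Y)" if "Y \<in> carrier_mat ?n ?n" for Y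
    using F twist_in_M0[OF that] hcomp_zero_eq unfolding is_graded_det_def G_def by blast
  have mult: "G (Y * Z) = G Y * G Z"
    if YZ: "Y \<in> carrier_mat ?n ?n" "Z \<in> carrier_mat ?n ?n" for Y Z
  proof -
    have "F (twist r (Y * Z)) = F (twist r Y) * F (twist r Z)"
      using F twist_in_M0[OF YZ(1)] twist_in_M0[OF YZ(2)]
      unfolding is_graded_det_def twist_mult[OF YZ] by blast
    then have "of_real (G (Y * Z)) = (of_real (G Y * G Z) :: quat)"
      using YZ by (simp add: FG)
    then show ?thesis by (simp only: of_real_eq_iff)
  qed
  have diag: "G (mat_diag ?n d) = det (mat_diag ?n d)" for d
  proof -
    let ?D = "mat_diag ?n d"
    have "twist r ?D $$ (i, j) = 0" if "i < ?n" "j < ?n" "block_index r i \<noteq> block_index r j" for i j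
      using that by (auto simp: twist_eq mat_diag_def)
    then have bd: "block_diagonal r (twist r ?D)"
      using r by (auto simp: block_diagonal_def block_upper_def block_lower_def block_eq_zero_iff)
    then have "F (twist r ?D) = of_real (\<Prod>k<4. det (map_mat qRe (block r (twist r ?D) k k)))"
      using F twist_in_M0[of ?D] unfolding is_graded_det_def by simp
    also have "\<dots> = of_real (det (untwist r (twist r ?D)))"
      using bd det_untwist_block_triangular by (simp add: block_diagonal_def)
    finally show ?thesis
      by (simp add: FG untwist_twist)
  qed
  have one: "G (1\<^sub>m ?n) = 1"
    using diag[of "\<lambda>_. 1"] by simp
  \<comment> \<open>Stated for any multiplicative \<open>H\<close>, so that it applies to \<open>G\<close> and to \<open>det\<close> alike.\<close>
  have transvections: "H T = 1" if T: "T \<in> transvection_products ?n"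
    and H: "\<And>Y Z. Y \<in> carrier_mat ?n ?n \<Longrightarrow> Z \<in> carrier_mat ?n ?n \<Longrightarrow> H (Y * Z) = H Y * H Z"
      "H (1\<^sub>m ?n) = 1" for H :: "real mat \<Rightarrow> real" and T
    by (rule multiplicative_transvection_products[OF T transvection_products_carrier H
          multiplicative_addrow_mat[OF H]])
  let ?Y = "untwist r X"
  obtain d S T where S: "S \<in> transvection_products ?n" and T: "T \<in> transvection_products ?n"
    and eq: "mat_diag ?n d = S * ?Y * T"
    using transvection_equiv_diagonal[OF untwist_carrier] unfolding transvection_equiv_def by blast
  have conjugate: "H (mat_diag ?n d) = H ?Y"
    if H: "\<And>Y Z. Y \<in> carrier_mat ?n ?n \<Longrightarrow> Z \<in> carrier_mat ?n ?n \<Longrightarrow> H (Y * Z) = H Y * H Z"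
      "H (1\<^sub>m ?n) = 1" for H :: "real mat \<Rightarrow> real"
  proof -
    note carrier = S[THEN transvection_products_carrier] T[THEN transvection_products_carrier]
    have "H (S * ?Y * T) = H S * H ?Y * H T"
      using carrier H(1)[of "S * ?Y" T] H(1)[of S ?Y] mult_carrier_mat[of S ?n ?n ?Y ?n]
      by simp
    then show ?thesis
      unfolding eq using transvections[OF S H] transvections[OF T H] by simp
  qed
  have "G ?Y = det ?Y"
    using conjugate[of G] conjugate[of det] diag[of d] mult one by (simp add: det_mult)
  then show ?thesis
    using FG[of ?Y] by (simp add: twist_untwist X)
qed

lemma graded_det_eq:
  assumes X: "X \<in> M0 r"
  shows "graded_det r X = of_real (det (untwist r X))"
proof -
  have "graded_det r = (\<lambda>X\<in>M0 r. of_real (det (untwist r X)))"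
    unfolding graded_det_def
  proof (rule the_equality)
    show "is_graded_det r (\<lambda>X\<in>M0 r. of_real (det (untwist r X)))"
      by (rule is_graded_det_untwist)
  next
    fix F assume F: "is_graded_det r F"
    then have "F \<in> extensional (M0 r)"
      by (auto simp: is_graded_det_def PiE_def)
    then show "F = (\<lambda>X\<in>M0 r. of_real (det (untwist r X)))"
      by (rule extensionalityI) (auto simp: graded_det_unique[OF F])
  qed
  then show ?thesis using X by simp
qed

section \<open>Comparison of the two determinants\<close>

lemma norm_det_twist:
  assumes Y: "Y \<in> carrier_mat (sum_list r) (sum_list r)"
  shows "norm_det (twist r Y) = \<bar>det Y\<bar>"
proof -
  let ?n = "sum_list r"
  have "norm_det (twist r Y) =
      norm_det (basis_diag r) * norm_det (map_mat of_real Y) * norm_det (basis_diag_inv r)"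
    unfolding twist_def using Y
      norm_det_mult[of "basis_diag r * map_mat of_real Y" ?n "basis_diag_inv r"]
      norm_det_mult[of "basis_diag r" ?n "map_mat of_real Y"]
      mult_carrier_mat[of "basis_diag r" ?n ?n "map_mat of_real Y" ?n] by simp
  moreover have "norm_det (basis_diag r) * norm_det (basis_diag_inv r) = 1"
    using norm_det_mult[of "basis_diag r" ?n "basis_diag_inv r"]
    by (simp add: basis_diag_inverse norm_det_one)
  ultimately show ?thesis
    using norm_det_of_real[OF Y] by (simp add: mult_ac)
qed

lemma twist_GL:
  assumes Y: "Y \<in> carrier_mat (sum_list r) (sum_list r)" and "det Y \<noteq> 0"
  shows "twist r Y \<in> GL (sum_list r)"
proof -
  let ?n = "sum_list r"
  obtain B where B: "B \<in> carrier_mat ?n ?n" "Y * B = 1\<^sub>m ?n" "B * Y = 1\<^sub>m ?n"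
    using det_non_zero_imp_unit[OF assms, of undefined]
    by (auto simp: Units_def ring_mat_def)
  have "twist r Y * twist r B = 1\<^sub>m ?n" "twist r B * twist r Y = 1\<^sub>m ?n"
    using B Y by (simp_all add: twist_mult[symmetric] twist_one)
  then show ?thesis
    unfolding GL_iff using twist_in_M0[OF Y] twist_in_M0[OF B(1)] by (auto simp: M0_def)
qed

end

text \<open>For singular \<open>X\<close> both sides vanish: the Dieudonne determinant by convention, and \<open>det Y\<close> because an
  invertible \<open>Y\<close> would twist to an invertible \<open>X\<close>.\<close>

theorem proposition7p1:
  fixes r :: "nat list" and X :: "quat mat"
  assumes "length r = 4" and "X \<in> M0 r"
  shows "\<exists>d :: real. graded_det r X = of_real d \<and> \<bar>d\<bar> = dieudonne_det X"
proof (intro exI conjI)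
  let ?Y = "untwist r X"
  show "graded_det r X = of_real (det ?Y)"
    using assms by (rule graded_det_eq)
  have X: "twist r ?Y = X"
    using assms by (rule twist_untwist)
  show "\<bar>det ?Y\<bar> = dieudonne_det X"
  proof (cases "X \<in> GL (sum_list r)")
    case True
    then show ?thesis
      using norm_det_twist[OF assms(1) untwist_carrier, of X]
      by (simp add: dieudonne_det_eq_norm_det X)
  next
    case False
    then have "det ?Y = 0"
      using twist_GL[OF assms(1) untwist_carrier, of X] X by auto
    moreover have "\<not> invertible_mat X"
      using False assms(2) by (simp add: GL_def M0_def)
    ultimately show ?thesis by (simp add: dieudonne_det_def)
  qed
qed

end
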